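(* Let $V$ be a complex Hilbert space with dual $V'$ and anti-duality $\langle\cdot,\cdot\rangle$, let $\sigma>0$, $\gamma\in\mathbb R$, and let $B(s):V\to V'$ and $R(s):V\to V$ be analytic families of bounded linear operators for $\mathrm{Re}\,s\ge\sigma$ with $\|B(s)\|_{V'\leftarrow V}\le M|s|^\mu$ and $\|R(s)\|_{V\leftarrow V}\le M|s|^\mu$ for $\mathrm{Re}\,s\ge\sigma$. Suppose that $$\mathrm{Re}\,\langle w,B(s)w\rangle\ge\gamma\,\|R(s)w\|^2\qquad\text{for all }w\in V,\ \mathrm{Re}\,s\ge\sigma.$$ Then, for $\sigma\Delta t>0$ small enough and with a $\rho=e^{-\sigma\Delta t}+O(\Delta t^2)$, $$\sum_{n=0}^\infty\rho^{2n}\,\mathrm{Re}\,\langle w(n\Delta t),B(\partial_t^{\Delta t})w(n\Delta t)\rangle\ \ge\ \gamma\sum_{n=0}^\infty\rho^{2n}\,\|R(\partial_t^{\Delta t})w(n\Delta t)\|^2$$ for any function $w:[0,\infty)\to V$ with finite support (bounded support).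
   Context: Convolution quadrature based on the second-order backward difference formula (BDF2): let $\delta(\zeta)=(1-\zeta)+\tfrac12(1-\zeta)^2$ and $\Delta t>0$. For an analytic operator family $A(s)$, the weights $A_n$ are defined by $A(\delta(\zeta)/\Delta t)=\sum_{n=0}^\infty A_n\zeta^n$, and $\big(A(\partial_t^{\Delta t})w\big)(n\Delta t)=\sum_{j=0}^nA_{n-j}\,w(j\Delta t)$. Here $A=B$ or $A=R$. The anti-duality $\langle\cdot,\cdot\rangle$ is antilinear in its first argument in $V$ and linear in its second argument in $V'$; $\|\cdot\|$ is the norm of $V$. The number $\rho$ depends on $\sigma$ and $\Delta t$ but not on $w$; $O(\Delta t^2)$ refers to $\Delta t\to0$ with $\sigma$ fixed. *)

theory Defs
  imports "HOL-Analysis.Analysis" "HOL-Library.Landau_Symbols"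
begin

class complex_normed_vector = real_normed_vector +
  fixes scaleC :: "complex \<Rightarrow> 'a \<Rightarrow> 'a"  (infixr "*\<^sub>C" 75)
  assumes scaleC_add_right: "c *\<^sub>C (x + y) = c *\<^sub>C x + c *\<^sub>C y"
    and scaleC_add_left: "(c + d) *\<^sub>C x = c *\<^sub>C x + d *\<^sub>C x"
    and scaleC_scaleC: "c *\<^sub>C (d *\<^sub>C x) = (c * d) *\<^sub>C x"
    and scaleC_of_real: "complex_of_real r *\<^sub>C x = r *\<^sub>R x"
    and norm_scaleC: "norm (c *\<^sub>C x) = norm c * norm x"

text \<open>The inner product is antilinear in its first argument.\<close>

class complex_hilbert_space = complex_normed_vector + complete_space +
  fixes cinner :: "'a \<Rightarrow> 'a \<Rightarrow> complex"
  assumes cinner_commute: "cinner x y = cnj (cinner y x)"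
    and cinner_add_right: "cinner x (y + z) = cinner x y + cinner x z"
    and cinner_scaleC_right: "cinner x (c *\<^sub>C y) = c * cinner x y"
    and cinner_same: "cinner x x = complex_of_real ((norm x)\<^sup>2)"

instantiation complex :: complex_hilbert_space
begin

definition scaleC_complex :: "complex \<Rightarrow> complex \<Rightarrow> complex"
  where "scaleC_complex c x = c * x"

definition cinner_complex :: "complex \<Rightarrow> complex \<Rightarrow> complex"
  where "cinner_complex x y = cnj x * y"

instance
proof
  fix c d x y z :: complex and r :: real
  show "c *\<^sub>C (x + y) = c *\<^sub>C x + c *\<^sub>C y"
    unfolding scaleC_complex_def by (rule distrib_left)
  show "(c + d) *\<^sub>C x = c *\<^sub>C x + d *\<^sub>C x"
    unfolding scaleC_complex_def by (rule distrib_right)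
  show "c *\<^sub>C (d *\<^sub>C x) = (c * d) *\<^sub>C x"
    unfolding scaleC_complex_def by (rule mult.assoc[symmetric])
  show "complex_of_real r *\<^sub>C x = r *\<^sub>R x"
    unfolding scaleC_complex_def by (rule scaleR_conv_of_real[symmetric])
  show "norm (c *\<^sub>C x) = norm c * norm x"
    unfolding scaleC_complex_def by (rule norm_mult)
  show "cinner x y = cnj (cinner y x)"
    unfolding cinner_complex_def by (simp add: mult.commute)
  show "cinner x (y + z) = cinner x y + cinner x z"
    unfolding cinner_complex_def by (rule distrib_left)
  show "cinner x (c *\<^sub>C y) = c * cinner x y"
    unfolding cinner_complex_def scaleC_complex_def by (rule mult.left_commute)
  show "cinner x x = complex_of_real ((norm x)\<^sup>2)"
    unfolding cinner_complex_def by (metis complex_norm_square mult.commute)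
qed

end

lemma bounded_linear_scaleC: "bounded_linear (\<lambda>x::'a::complex_normed_vector. c *\<^sub>C x)"
proof (rule bounded_linear_intro)
  fix x y :: 'a and r :: real
  show "c *\<^sub>C (x + y) = c *\<^sub>C x + c *\<^sub>C y"
    by (rule scaleC_add_right)
  show "c *\<^sub>C (r *\<^sub>R x) = r *\<^sub>R (c *\<^sub>C x)"
    by (metis scaleC_of_real scaleC_scaleC mult.commute)
  show "norm (c *\<^sub>C x) \<le> norm x * norm c"
    by (simp add: norm_scaleC)
qed

text \<open>
  Operators are elements of the library type of bounded real-linear maps, which carries the
  operator norm; complex (anti)linearity is imposed by the predicates below, each of which
  cuts out a closed complex subspace.
\<close>

instantiation blinfun :: (real_normed_vector, complex_normed_vector) complex_normed_vector
begin

lift_definition scaleC_blinfun :: "complex \<Rightarrow> 'a \<Rightarrow>\<^sub>L 'b \<Rightarrow> 'a \<Rightarrow>\<^sub>L 'b"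
  is "\<lambda>c f x. c *\<^sub>C f x"
  by (rule bounded_linear_compose[OF bounded_linear_scaleC])

instance
proof
  fix c d :: complex and f g :: "'a \<Rightarrow>\<^sub>L 'b" and r :: real
  show "c *\<^sub>C (f + g) = c *\<^sub>C f + c *\<^sub>C g"
    by transfer (simp add: scaleC_add_right)
  show "(c + d) *\<^sub>C f = c *\<^sub>C f + d *\<^sub>C f"
    by transfer (simp add: scaleC_add_left)
  show scaleC_scaleC_blinfun: "c *\<^sub>C (d *\<^sub>C f) = (c * d) *\<^sub>C f"
    for c d and f :: "'a \<Rightarrow>\<^sub>L 'b"
    by transfer (simp add: scaleC_scaleC)
  show of_real: "complex_of_real r *\<^sub>C f = r *\<^sub>R f" for r and f :: "'a \<Rightarrow>\<^sub>L 'b"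
    by transfer (simp add: scaleC_of_real)
  have le: "norm (c *\<^sub>C f) \<le> norm c * norm f" for c and f :: "'a \<Rightarrow>\<^sub>L 'b"
  proof (rule norm_blinfun_bound)
    fix x
    show "norm (blinfun_apply (c *\<^sub>C f) x) \<le> norm c * norm f * norm x"
      using mult_left_mono[OF norm_blinfun[of f x] norm_ge_zero[of c]]
      by (simp add: scaleC_blinfun.rep_eq norm_scaleC mult.assoc)
  qed simp
  show "norm (c *\<^sub>C f) = norm c * norm f"
  proof (cases "c = 0")
    case True
    then show ?thesis
      using le[of c f] by simp
  next
    case False
    have "inverse c *\<^sub>C (c *\<^sub>C f) = 1 *\<^sub>R f"
      using False of_real[of 1 f] by (simp add: scaleC_scaleC_blinfun)
    then have "norm f \<le> norm (inverse c) * norm (c *\<^sub>C f)"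
      using le[of "inverse c" "c *\<^sub>C f"] by simp
    then have "norm c * norm f \<le> norm (c *\<^sub>C f)"
      using False mult_left_mono[of "norm f" _ "norm c"]
      by (fastforce simp: norm_inverse simp flip: mult.assoc)
    then show ?thesis
      using le[of c f] by simp
  qed
qed

end

definition complex_linear_op ::
  "'a::complex_normed_vector \<Rightarrow>\<^sub>L 'b::complex_normed_vector \<Rightarrow> bool"
  where "complex_linear_op A \<longleftrightarrow> (\<forall>c x. blinfun_apply A (c *\<^sub>C x) = c *\<^sub>C blinfun_apply A x)"

text \<open>
  The dual $V'$ consists of the bounded antilinear functionals with pointwise operations, so
  that evaluation is antilinear in the vector and linear in the functional.
\<close>

definition antidual :: "('v::complex_normed_vector \<Rightarrow>\<^sub>L complex) set"
  where "antidual = {f. \<forall>c v. blinfun_apply f (c *\<^sub>C v) = cnj c * blinfun_apply f v}"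

definition anti_duality :: "'v::complex_normed_vector \<Rightarrow> ('v \<Rightarrow>\<^sub>L complex) \<Rightarrow> complex"
  where "anti_duality v f = blinfun_apply f v"

text \<open>
  Analyticity of vector-valued functions, patterned after \<open>analytic_on\<close>: complex
  differentiability, in norm, on a neighbourhood of every point of the set.
\<close>

definition complex_differentiable_at ::
  "(complex \<Rightarrow> 'b::complex_normed_vector) \<Rightarrow> complex \<Rightarrow> bool"
  where "complex_differentiable_at f s \<longleftrightarrow>
    (\<exists>D. ((\<lambda>z. inverse (z - s) *\<^sub>C (f z - f s)) \<longlongrightarrow> D) (at s))"

definition vector_analytic_on ::
  "(complex \<Rightarrow> 'b::complex_normed_vector) \<Rightarrow> complex set \<Rightarrow> bool"
  where "vector_analytic_on f S \<longleftrightarrow>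
    (\<forall>s\<in>S. \<exists>e>0. \<forall>z\<in>ball s e. complex_differentiable_at f z)"

definition bdf2 :: "complex \<Rightarrow> complex"
  where "bdf2 \<zeta> = (1 - \<zeta>) + (1 - \<zeta>)\<^sup>2 / 2"

text \<open>
  The weights are the Taylor coefficients at $0$ of the generating function; the expansion on
  some disc about $0$ determines them uniquely.
\<close>

definition cq_weight ::
  "(complex \<Rightarrow> 'b::complex_normed_vector) \<Rightarrow> real \<Rightarrow> nat \<Rightarrow> 'b"
  where "cq_weight A \<Delta>t = (THE W. \<exists>r>0. \<forall>\<zeta>. norm \<zeta> < r \<longrightarrow>
    (\<lambda>n. \<zeta> ^ n *\<^sub>C W n) sums A (bdf2 \<zeta> / complex_of_real \<Delta>t))"

text \<open>\<open>conv_quad A \<Delta>t w n\<close> is $(A(\partial_t^{\Delta t})w)(n\Delta t)$.\<close>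

definition conv_quad ::
  "(complex \<Rightarrow> 'a::complex_normed_vector \<Rightarrow>\<^sub>L 'b::complex_normed_vector) \<Rightarrow> real \<Rightarrow>
    (real \<Rightarrow> 'a) \<Rightarrow> nat \<Rightarrow> 'b"
  where "conv_quad A \<Delta>t w n =
    (\<Sum>j=0..n. blinfun_apply (cq_weight A \<Delta>t (n - j)) (w (real j * \<Delta>t)))"

end

theory Submission
  imports Defs "HOL-Complex_Analysis.Cauchy_Integral_Formula" "HOL-Real_Asymp.Real_Asymp"
begin

text \<open>
  The generating function of the weights is $F(\zeta) = A(\delta(\zeta)/\Delta t)$, so that on
  $|\zeta| = \rho$ the discrete convolution becomes multiplication of
  $\hat w(\zeta) = \sum_j \zeta^j w(j\Delta t)$ by $F(\zeta)$, and by Parseval the two weighted sums are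
  the means over this circle of $\mathrm{Re}\,\langle \hat w, B(s)\hat w\rangle$ and $\|R(s)\hat w\|^2$
  with $s = \delta(\zeta)/\Delta t$. The assumed inequality applies pointwise as soon as
  $\mathrm{Re}\,\delta(\zeta) \ge \sigma\Delta t$ on the disc. The minimum of $\mathrm{Re}\,\delta$ on
  $|\zeta| \le \rho \le 1$ is $\delta(\rho) = (1-\rho)(3-\rho)/2$, which equals $\sigma\Delta t$ for
  $\rho = 2 - \sqrt{1 + 2\sigma\Delta t}$.
\<close>

section \<open>Complex Hilbert spaces\<close>

instance complex_hilbert_space \<subseteq> banach ..

text \<open>As a bounded bilinear map, scalar multiplication inherits the rules for continuity,
  limits and sums used below for power series and circle integrals.\<close>

lemma bounded_bilinear_scaleC:
  "bounded_bilinear (scaleC :: complex \<Rightarrow> 'a::complex_normed_vector \<Rightarrow> 'a)"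
proof
  fix c d :: complex and x y :: 'a and r :: real
  show "(c + d) *\<^sub>C x = c *\<^sub>C x + d *\<^sub>C x"
    by (rule scaleC_add_left)
  show "c *\<^sub>C (x + y) = c *\<^sub>C x + c *\<^sub>C y"
    by (rule scaleC_add_right)
  show "(r *\<^sub>R c) *\<^sub>C x = r *\<^sub>R (c *\<^sub>C x)"
    by (simp add: scaleR_conv_of_real flip: scaleC_scaleC scaleC_of_real)
  show "c *\<^sub>C (r *\<^sub>R x) = r *\<^sub>R (c *\<^sub>C x)"
    by (simp add: scaleC_scaleC mult.commute flip: scaleC_of_real)
  show "\<exists>K. \<forall>(c::complex) (x::'a). norm (c *\<^sub>C x) \<le> norm c * norm x * K"
    by (intro exI[of _ 1]) (simp add: norm_scaleC)
qed

interpretation scaleC: bounded_bilinear "scaleC :: complex \<Rightarrow> 'a::complex_normed_vector \<Rightarrow> 'a"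
  by (rule bounded_bilinear_scaleC)

lemma scaleC_one [simp]: "1 *\<^sub>C (x :: 'a::complex_normed_vector) = x"
  using scaleC_of_real[of 1 x] by simp

lemma cinner_add_left: "cinner (x + y) z = cinner x z + cinner y z"
  by (metis cinner_add_right cinner_commute complex_cnj_add)

lemma cinner_scaleC_left: "cinner (c *\<^sub>C x) y = cnj c * cinner x y"
  by (metis cinner_commute cinner_scaleC_right complex_cnj_mult)

lemma cinner_zero_right [simp]: "cinner x 0 = 0"
  using cinner_add_right[of x 0 0] by simp

lemma cinner_cauchy_schwarz: "norm (cinner x y) \<le> norm x * norm y"
proof (cases "y = 0")
  case False
  \<comment> \<open>With this \<open>c\<close> the vector \<open>z\<close> is orthogonal to
    \<open>y\<close>; the inequality is the nonnegativity of the squared norm of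
    \<open>z\<close>.\<close>
  define c where "c = - cinner y x / complex_of_real ((norm y)\<^sup>2)"
  define z where "z = x + c *\<^sub>C y"
  have "complex_of_real ((norm z)\<^sup>2) = cinner z z"
    by (simp add: cinner_same)
  also have "\<dots> = cinner x x + c * cinner x y + cnj c * cinner y x + cnj c * c * cinner y y"
    by (simp add: z_def cinner_add_left cinner_add_right cinner_scaleC_left cinner_scaleC_right
        algebra_simps)
  also have "\<dots> = cinner x x - (norm (cinner x y))\<^sup>2 / (norm y)\<^sup>2"
    using False cinner_commute[of y x] complex_norm_square[of "cinner x y"]
    by (simp add: c_def cinner_same field_simps power2_eq_square)
  also have "\<dots> = complex_of_real ((norm x)\<^sup>2 - (norm (cinner x y))\<^sup>2 / (norm y)\<^sup>2)"
    by (simp add: cinner_same)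
  finally have "(norm z)\<^sup>2 = (norm x)\<^sup>2 - (norm (cinner x y))\<^sup>2 / (norm y)\<^sup>2"
    using of_real_eq_iff by blast
  then have "(norm (cinner x y))\<^sup>2 / (norm y)\<^sup>2 \<le> (norm x)\<^sup>2"
    by (smt (verit) zero_le_power2)
  then have "(norm (cinner x y))\<^sup>2 \<le> (norm x * norm y)\<^sup>2"
    using False by (simp add: field_simps power_mult_distrib)
  then show ?thesis
    by (rule power2_le_imp_le) simp
qed simp

lemma bounded_bilinear_cinner:
  "bounded_bilinear (cinner :: 'a::complex_hilbert_space \<Rightarrow> 'a \<Rightarrow> complex)"
proof
  fix x y z :: 'a and r :: real
  show "cinner (x + y) z = cinner x z + cinner y z"
    by (rule cinner_add_left)
  show "cinner x (y + z) = cinner x y + cinner x z"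
    by (rule cinner_add_right)
  show "cinner (r *\<^sub>R x) y = r *\<^sub>R cinner x y"
    by (simp add: cinner_scaleC_left scaleR_conv_of_real flip: scaleC_of_real)
  show "cinner x (r *\<^sub>R y) = r *\<^sub>R cinner x y"
    by (simp add: cinner_scaleC_right scaleR_conv_of_real flip: scaleC_of_real)
  show "\<exists>K. \<forall>(x::'a) y. norm (cinner x y) \<le> norm x * norm y * K"
    by (intro exI[of _ 1]) (simp add: cinner_cauchy_schwarz)
qed

section \<open>Parseval's identity on a circle\<close>

text \<open>The majorant \<open>M\<close> makes the series converge uniformly, so the integrals of
  the partial sums converge to the integral of the sum. That convergence is also what gives
  summability of \<open>I\<close>.\<close>

lemma has_integral_series:
  fixes t :: "nat \<Rightarrow> real \<Rightarrow> 'a::banach"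
  assumes cont: "\<And>n. continuous_on {a..b} (t n)"
    and bound: "\<And>n x. x \<in> {a..b} \<Longrightarrow> norm (t n x) \<le> M n" "summable M"
    and int: "\<And>n. (t n has_integral I n) {a..b}"
    and sums: "\<And>x. x \<in> {a..b} \<Longrightarrow> (\<lambda>n. t n x) sums f x"
  shows "summable I" "(f has_integral suminf I) {a..b}"
proof -
  have u: "uniform_limit {a..b} (\<lambda>n x. \<Sum>i<n. t i x) (\<lambda>x. \<Sum>i. t i x) sequentially"
    by (rule Weierstrass_m_test[OF bound])
  obtain S J where S: "\<And>n. ((\<lambda>x. \<Sum>i<n. t i x) has_integral S n) {a..b}"
    and J: "((\<lambda>x. \<Sum>i. t i x) has_integral J) {a..b}" "S \<longlonglongrightarrow> J"
    by (rule uniform_limit_integral[OF u]) (auto intro!: continuous_on_sum cont)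
  have "S = (\<lambda>n. \<Sum>i<n. I i)"
    by (rule ext, rule has_integral_unique[OF S]) (intro has_integral_sum int, simp)
  with J(2) have "I sums J"
    by (simp add: sums_def)
  then show "summable I" and "(f has_integral suminf I) {a..b}"
    using has_integral_eq[OF _ J(1), of f] sums by (auto simp: sums_iff)
qed

lemma has_integral_cis_mult:
  "((\<lambda>\<theta>. cnj (cis (real j * \<theta>)) * cis (real n * \<theta>)) has_integral (if j = n then of_real (2 * pi) else 0))
    {0..2 * pi}"
proof (cases "j = n")
  case True
  then show ?thesis
    using has_integral_const_real[of "1 :: complex" 0 "2 * pi"]
    by (simp add: cis_cnj cis_mult scaleR_conv_of_real)
next
  case False
  define k where "k = real n - real j"
  have k: "k \<noteq> 0"
    using False by (simp add: k_def)
  have ii: "\<i> * (x * (\<i> * y)) = - (x * y)" for x y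
    by (simp add: complex_eq_iff)
  have "((\<lambda>\<theta>. cis (k * \<theta>) / (\<i> * of_real k)) has_vector_derivative cis (k * \<theta>))
      (at \<theta> within {0..2 * pi})" for \<theta>
    using k unfolding has_vector_derivative_def
    by (auto intro!: derivative_eq_intros simp: fun_eq_iff scaleR_conv_of_real ii)
  then have "((\<lambda>\<theta>. cis (k * \<theta>)) has_integral
      cis (k * (2 * pi)) / (\<i> * of_real k) - cis (k * 0) / (\<i> * of_real k)) {0..2 * pi}"
    by (intro fundamental_theorem_of_calculus) auto
  \<comment> \<open>As \<open>k\<close> is an integer, the antiderivative has period 2 pi and its
    boundary values cancel.\<close>
  moreover have "cis (k * (2 * pi)) = 1"
  proof -
    have "k \<in> \<int>"
      by (simp add: k_def)
    then show ?thesis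
      using cis_multiple_2pi[of k] by (simp add: mult_ac)
  qed
  ultimately show ?thesis
    using False by (simp add: cis_cnj cis_mult k_def algebra_simps)
qed

text \<open>Absolute summability allows termwise integration, and orthogonality of the exponentials
  leaves only the term with index \<open>j\<close>. This is the device for reading off coefficients
  throughout.\<close>

lemma has_integral_circle_coeff:
  fixes b :: "nat \<Rightarrow> complex"
  assumes b: "summable (\<lambda>n. norm (b n))"
    and f: "\<And>\<theta>. (\<lambda>n. cis (real n * \<theta>) * b n) sums f \<theta>"
  shows "((\<lambda>\<theta>. cnj (cis (real j * \<theta>)) * f \<theta>) has_integral of_real (2 * pi) * b j) {0..2 * pi}"
proof -
  let ?t = "\<lambda>n \<theta>. cnj (cis (real j * \<theta>)) * (cis (real n * \<theta>) * b n)"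
  let ?I = "\<lambda>n. (if j = n then of_real (2 * pi) else 0) * b n"
  have "(?t n has_integral ?I n) {0..2 * pi}" for n
    using has_integral_mult_left[OF has_integral_cis_mult[of j n], of "b n"] by (simp add: mult.assoc)
  then have "((\<lambda>\<theta>. cnj (cis (real j * \<theta>)) * f \<theta>) has_integral suminf ?I) {0..2 * pi}"
    by (intro has_integral_series(2)[of _ _ ?t "\<lambda>n. norm (b n)"] b sums_mult f)
      (auto intro!: continuous_intros simp: norm_mult)
  moreover have "?I = (\<lambda>n. if n = j then of_real (2 * pi) * b n else 0)"
    by auto
  then have "suminf ?I = of_real (2 * pi) * b j"
    using sums_single[of j "\<lambda>n. of_real (2 * pi) * b n"] by (simp only: sums_iff)
  ultimately show ?thesis
    by simp
qed

text \<open>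
  Antilinearity is required only against the values of \<open>V\<close>: the values of $B(s)$ are antilinear by
  assumption, and antilinearity of the weights need not be derived.
\<close>

lemma circle_parseval:
  fixes p :: "'a::complex_normed_vector \<Rightarrow> 'b::{banach, complex_normed_vector} \<Rightarrow> complex"
  assumes p: "bounded_bilinear p"
    and right: "\<And>c x y. p x (c *\<^sub>C y) = c * p x y"
    and left: "\<And>c x \<theta>. p (c *\<^sub>C x) (V \<theta>) = cnj c * p x (V \<theta>)"
    and a: "summable (\<lambda>n. norm (a n))" and b: "summable (\<lambda>n. norm (b n))"
    and U: "\<And>\<theta>. (\<lambda>n. cis (real n * \<theta>) *\<^sub>C a n) sums U \<theta>"
    and V: "\<And>\<theta>. (\<lambda>n. cis (real n * \<theta>) *\<^sub>C b n) sums V \<theta>"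
  shows "summable (\<lambda>n. p (a n) (b n))"
    and "((\<lambda>\<theta>. p (U \<theta>) (V \<theta>)) has_integral of_real (2 * pi) * (\<Sum>n. p (a n) (b n))) {0..2 * pi}"
proof -
  interpret p: bounded_bilinear p
    by (rule p)
  obtain K where K: "K > 0" "\<And>x y. norm (p x y) \<le> norm x * norm y * K"
    using p.pos_bounded by blast
  \<comment> \<open>As a uniform limit of trigonometric polynomials \<open>V\<close> is continuous,
    which termwise integration of the pairing asks for.\<close>
  have ub: "uniform_limit UNIV (\<lambda>n \<theta>. \<Sum>i<n. cis (real i * \<theta>) *\<^sub>C b i)
      (\<lambda>\<theta>. \<Sum>n. cis (real n * \<theta>) *\<^sub>C b n) sequentially"
    by (rule Weierstrass_m_test[OF _ b]) (simp add: norm_scaleC)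
  have Veq: "V = (\<lambda>\<theta>. \<Sum>n. cis (real n * \<theta>) *\<^sub>C b n)"
    using V by (auto simp: sums_iff)
  have contV: "continuous_on UNIV V"
    unfolding Veq
    by (rule uniform_limit_theorem[OF _ ub])
      (auto intro!: continuous_intros always_eventually scaleC.continuous_on)
  have normV: "norm (V \<theta>) \<le> (\<Sum>n. norm (b n))" for \<theta>
  proof -
    have "norm (\<Sum>n. cis (real n * \<theta>) *\<^sub>C b n) \<le> (\<Sum>n. norm (cis (real n * \<theta>) *\<^sub>C b n))"
      using b by (intro summable_norm) (simp add: norm_scaleC)
    then show ?thesis
      by (simp add: Veq norm_scaleC)
  qed
  \<comment> \<open>Only \<open>U\<close> is expanded at first: the scalar leaves the left slot
    while the right slot still holds the full value \<open>V \<theta>\<close>, as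
    \<open>left\<close> demands. Then \<open>V\<close> is expanded, and its coefficient
    \<open>b j\<close> is selected by the integral.\<close>
  let ?t = "\<lambda>j \<theta>. p (cis (real j * \<theta>) *\<^sub>C a j) (V \<theta>)"
  let ?I = "\<lambda>j. of_real (2 * pi) * p (a j) (b j)"
  have int: "(?t j has_integral ?I j) {0..2 * pi}" for j
  proof -
    have "summable (\<lambda>n. norm (p (a j) (b n)))"
    proof (rule summable_comparison_test)
      show "\<exists>N. \<forall>n\<ge>N. norm (norm (p (a j) (b n))) \<le> norm (a j) * K * norm (b n)"
        using K(2)[of "a j" "b _"] by (simp add: mult_ac)
      show "summable (\<lambda>n. norm (a j) * K * norm (b n))"
        by (intro summable_mult b)
    qed
    moreover have "(\<lambda>n. cis (real n * \<theta>) * p (a j) (b n)) sums p (a j) (V \<theta>)" for \<theta>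
      using bounded_linear.sums[OF p.bounded_linear_right V] by (simp add: right)
    ultimately show ?thesis
      using has_integral_circle_coeff[of "\<lambda>n. p (a j) (b n)"] by (simp add: left)
  qed
  have bound: "norm (?t j \<theta>) \<le> K * (\<Sum>n. norm (b n)) * norm (a j)" for j \<theta>
  proof -
    have "norm (?t j \<theta>) \<le> norm (a j) * norm (V \<theta>) * K"
      using K(2)[of "cis (real j * \<theta>) *\<^sub>C a j" "V \<theta>"] by (simp add: norm_scaleC)
    also have "\<dots> \<le> norm (a j) * (\<Sum>n. norm (b n)) * K"
      using K(1) by (intro mult_right_mono mult_left_mono normV) auto
    finally show ?thesis
      by (simp add: mult_ac)
  qed
  have cont: "continuous_on {0..2 * pi} (?t j)" for j
    by (intro p.continuous_on scaleC.continuous_on continuous_intros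
        continuous_on_subset[OF contV]) auto
  have sums: "(\<lambda>j. ?t j \<theta>) sums p (U \<theta>) (V \<theta>)" for \<theta>
    by (rule bounded_linear.sums[OF p.bounded_linear_left U])
  note series = has_integral_series[OF cont bound summable_mult[OF a] int sums]
  show *: "summable (\<lambda>n. p (a n) (b n))"
    using series(1) by (simp add: summable_cmult_iff)
  show "((\<lambda>\<theta>. p (U \<theta>) (V \<theta>)) has_integral of_real (2 * pi) * (\<Sum>n. p (a n) (b n))) {0..2 * pi}"
    using series(2) by (simp only: suminf_mult[OF *])
qed

lemma mult_circle_power:
  "a * (of_real q * cis \<theta>) ^ n = cis (real n * \<theta>) * (a * of_real q ^ n)"
  by (simp add: power_mult_distrib Complex.DeMoivre)

text \<open>The powers of \<rho> are absorbed into the coefficients. Being real scalars they leave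
  both slots of \<open>p\<close> by real bilinearity, one factor \<open>\<rho> ^ n\<close> from
  each, which produces the weight \<open>\<rho> ^ (2 * n)\<close>.\<close>

lemma circle_parseval_Re:
  fixes p :: "'a::complex_normed_vector \<Rightarrow> 'b::{banach, complex_normed_vector} \<Rightarrow> complex"
  assumes p: "bounded_bilinear p"
    and right: "\<And>c x y. p x (c *\<^sub>C y) = c * p x y"
    and left: "\<And>c x \<theta>. p (c *\<^sub>C x) (V \<theta>) = cnj c * p x (V \<theta>)"
    and x: "summable (\<lambda>n. norm (of_real \<rho> ^ n *\<^sub>C x n))"
    and y: "summable (\<lambda>n. norm (of_real \<rho> ^ n *\<^sub>C y n))"
    and U: "\<And>\<theta>. (\<lambda>n. (of_real \<rho> * cis \<theta>) ^ n *\<^sub>C x n) sums U \<theta>"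
    and V: "\<And>\<theta>. (\<lambda>n. (of_real \<rho> * cis \<theta>) ^ n *\<^sub>C y n) sums V \<theta>"
  shows "summable (\<lambda>n. \<rho> ^ (2 * n) * Re (p (x n) (y n)))"
    and "((\<lambda>\<theta>. Re (p (U \<theta>) (V \<theta>))) has_integral
      2 * pi * (\<Sum>n. \<rho> ^ (2 * n) * Re (p (x n) (y n)))) {0..2 * pi}"
proof -
  interpret p: bounded_bilinear p
    by (rule p)
  have split: "(of_real \<rho> * cis \<theta>) ^ n *\<^sub>C z = cis (real n * \<theta>) *\<^sub>C (\<rho> ^ n *\<^sub>R z)"
    for \<theta> n and z :: "'c::complex_normed_vector"
    using mult_circle_power[of 1 \<rho> \<theta> n] by (simp add: scaleC_scaleC flip: scaleC_of_real)
  have real_split: "of_real \<rho> ^ n *\<^sub>C z = \<rho> ^ n *\<^sub>R z"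
    for n and z :: "'c::complex_normed_vector"
    by (simp flip: scaleC_of_real)
  have eq: "p (\<rho> ^ n *\<^sub>R x n) (\<rho> ^ n *\<^sub>R y n) = of_real (\<rho> ^ (2 * n)) * p (x n) (y n)" for n
    by (simp add: p.scaleR_left p.scaleR_right scaleR_conv_of_real mult_2 power_add)
  note parseval = circle_parseval[OF p right left x[unfolded real_split] y[unfolded real_split]
      U[unfolded split] V[unfolded split], unfolded eq]
  have sum: "summable (\<lambda>n. of_real (\<rho> ^ (2 * n)) * p (x n) (y n))"
    by (rule parseval(1))
  show "summable (\<lambda>n. \<rho> ^ (2 * n) * Re (p (x n) (y n)))"
    using summable_Re[OF sum] by simp
  have "((\<lambda>\<theta>. Re (p (U \<theta>) (V \<theta>))) has_integral
      Re (of_real (2 * pi) * (\<Sum>n. of_real (\<rho> ^ (2 * n)) * p (x n) (y n)))) {0..2 * pi}"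
    using has_integral_linear[OF parseval(2) bounded_linear_Re] by (simp add: o_def)
  also have "Re (of_real (2 * pi) * (\<Sum>n. of_real (\<rho> ^ (2 * n)) * p (x n) (y n)))
      = 2 * pi * (\<Sum>n. Re (of_real (\<rho> ^ (2 * n)) * p (x n) (y n)))"
    by (simp only: Re_complex_of_real Im_complex_of_real times_complex.simps Re_suminf[OF sum] mult_zero_left diff_zero)
  finally show "((\<lambda>\<theta>. Re (p (U \<theta>) (V \<theta>))) has_integral
      2 * pi * (\<Sum>n. \<rho> ^ (2 * n) * Re (p (x n) (y n)))) {0..2 * pi}"
    by simp
qed

section \<open>Power series of vector-valued analytic functions\<close>

text \<open>
  A separating family of functionals reduces identities between vector-valued power series to the
  scalar theory without the Hahn-Banach theorem.
\<close>

definition separating_functionals :: "('b::complex_normed_vector \<Rightarrow> complex) set \<Rightarrow> bool"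
  where "separating_functionals \<Phi> \<longleftrightarrow>
    (\<forall>\<phi>\<in>\<Phi>. bounded_linear \<phi> \<and> (\<forall>c x. \<phi> (c *\<^sub>C x) = c * \<phi> x)) \<and>
    (\<forall>x y. (\<forall>\<phi>\<in>\<Phi>. \<phi> x = \<phi> y) \<longrightarrow> x = y)"

text \<open>Testing at \<open>v\<close> against the difference of the two images of \<open>v\<close>
  returns the squared norm of that difference. This family serves \<open>R\<close>.\<close>

lemma separating_functionals_cinner:
  "separating_functionals (range (\<lambda>(v, u) (T :: 'v::complex_hilbert_space \<Rightarrow>\<^sub>L 'v). cinner u (blinfun_apply T v)))"
  unfolding separating_functionals_def
proof (intro conjI ballI allI impI)
  fix \<phi> :: "('v \<Rightarrow>\<^sub>L 'v) \<Rightarrow> complex" and c T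
  assume "\<phi> \<in> range (\<lambda>(v, u) T. cinner u (blinfun_apply T v))"
  then obtain v u where \<phi>: "\<phi> = (\<lambda>T. cinner u (blinfun_apply T v))"
    by auto
  show "bounded_linear \<phi>"
    unfolding \<phi> by (intro bounded_linear_compose[OF
        bounded_bilinear.bounded_linear_right[OF bounded_bilinear_cinner]] blinfun.bounded_linear_left)
  show "\<phi> (c *\<^sub>C T) = c * \<phi> T"
    by (simp add: \<phi> scaleC_blinfun.rep_eq cinner_scaleC_right)
next
  fix T T' :: "'v \<Rightarrow>\<^sub>L 'v"
  assume eq: "\<forall>\<phi>\<in>range (\<lambda>(v, u) T. cinner u (blinfun_apply T v)). \<phi> T = \<phi> T'"
  show "T = T'"
  proof (rule blinfun_eqI)
    fix v
    let ?u = "blinfun_apply T v - blinfun_apply T' v"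
    have "cinner ?u (blinfun_apply T v) = cinner ?u (blinfun_apply T' v)"
      using eq by auto
    then have "cinner ?u ?u = 0"
      by (simp add: bounded_bilinear.diff_right[OF bounded_bilinear_cinner])
    then show "blinfun_apply T v = blinfun_apply T' v"
      by (simp add: cinner_same)
  qed
qed

text \<open>An operator into functionals is determined by evaluating twice. This family serves
  \<open>B\<close>.\<close>

lemma separating_functionals_apply:
  "separating_functionals (range (\<lambda>(v, u)
    (T :: 'v::complex_normed_vector \<Rightarrow>\<^sub>L ('u::complex_normed_vector \<Rightarrow>\<^sub>L complex)).
      blinfun_apply (blinfun_apply T v) u))"
  unfolding separating_functionals_def
proof (intro conjI ballI allI impI)
  fix \<phi> :: "('v \<Rightarrow>\<^sub>L ('u \<Rightarrow>\<^sub>L complex)) \<Rightarrow> complex" and c T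
  assume "\<phi> \<in> range (\<lambda>(v, u) T. blinfun_apply (blinfun_apply T v) u)"
  then obtain v u where \<phi>: "\<phi> = (\<lambda>T. blinfun_apply (blinfun_apply T v) u)"
    by auto
  show "bounded_linear \<phi>"
    unfolding \<phi>
    by (intro bounded_linear_compose[OF blinfun.bounded_linear_left] blinfun.bounded_linear_left)
  show "\<phi> (c *\<^sub>C T) = c * \<phi> T"
    by (simp add: \<phi> scaleC_blinfun.rep_eq scaleC_complex_def)
next
  fix T T' :: "'v \<Rightarrow>\<^sub>L ('u \<Rightarrow>\<^sub>L complex)"
  assume eq: "\<forall>\<phi>\<in>range (\<lambda>(v, u) T. blinfun_apply (blinfun_apply T v) u). \<phi> T = \<phi> T'"
  show "T = T'"
    by (intro blinfun_eqI) (use eq in auto)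
qed

text \<open>
  The coefficients are Cauchy integrals over the circle of radius $r$, so that the series converges
  in norm; the functionals identify its sum.
\<close>

lemma vector_power_series:
  fixes F :: "complex \<Rightarrow> 'b::{banach, complex_normed_vector}"
  assumes sep: "separating_functionals \<Phi>"
    and cont: "continuous_on (ball 0 R) F"
    and hol: "\<And>\<phi>. \<phi> \<in> \<Phi> \<Longrightarrow> (\<lambda>z. \<phi> (F z)) holomorphic_on ball 0 R"
    and r: "0 < r" "r < R"
  obtains W where "\<And>\<zeta>. norm \<zeta> < r \<Longrightarrow> summable (\<lambda>n. norm (\<zeta> ^ n *\<^sub>C W n))"
    and "\<And>\<zeta>. norm \<zeta> < r \<Longrightarrow> (\<lambda>n. \<zeta> ^ n *\<^sub>C W n) sums F \<zeta>"
proof -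
  let ?G = "\<lambda>\<theta>. F (of_real r * cis \<theta>)"
  define J where "J n = integral {0..2 * pi} (\<lambda>\<theta>. cnj (cis (real n * \<theta>)) *\<^sub>C ?G \<theta>)" for n
  define W where "W n = inverse (of_real (2 * pi) * of_real r ^ n) *\<^sub>C J n" for n
  have contG: "continuous_on {0..2 * pi} ?G"
    using r by (intro continuous_on_compose2[OF cont] continuous_intros) (auto simp: norm_mult)
  have contI: "continuous_on {0..2 * pi} (\<lambda>\<theta>. cnj (cis (real n * \<theta>)) *\<^sub>C ?G \<theta>)" for n
    by (intro scaleC.continuous_on contG continuous_intros)
  have "compact (?G ` {0..2 * pi})"
    by (intro compact_continuous_image contG) simp
  then obtain C where C: "\<And>\<theta>. \<theta> \<in> {0..2 * pi} \<Longrightarrow> norm (?G \<theta>) \<le> C"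
    by (meson bounded_iff compact_imp_bounded imageI)
  \<comment> \<open>Cauchy's estimate: the bound \<open>C\<close> on the circle gives
    \<open>C / r ^ n\<close> for the coefficients, hence a geometric majorant at every point of
    modulus below \<open>r\<close>.\<close>
  have "norm (J n) \<le> C * (2 * pi - 0)" for n
    unfolding J_def by (intro integral_bound contI) (auto simp: norm_scaleC C)
  then have "norm (J n) / (2 * pi) \<le> C" for n
    by (simp add: field_simps)
  moreover have "norm (W n) = inverse (2 * pi) * inverse (r ^ n) * norm (J n)" for n
    using r by (simp add: W_def norm_scaleC norm_mult norm_inverse norm_power)
  then have "norm (W n) = norm (J n) / (2 * pi) / r ^ n" for n
    by (simp add: field_simps)
  ultimately have W_le: "norm (W n) \<le> C / r ^ n" for n
    using r by (simp del: divide_divide_eq_left add: divide_right_mono)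
  have summ: "summable (\<lambda>n. norm (\<zeta> ^ n *\<^sub>C W n))" if "norm \<zeta> < r" for \<zeta>
  proof (rule summable_comparison_test)
    show "\<exists>N. \<forall>n\<ge>N. norm (norm (\<zeta> ^ n *\<^sub>C W n)) \<le> C * (norm \<zeta> / r) ^ n"
      using mult_left_mono[OF W_le, of "norm \<zeta> ^ _"]
      by (simp add: norm_scaleC norm_power power_divide mult.commute)
    show "summable (\<lambda>n. C * (norm \<zeta> / r) ^ n)"
      using that r by (intro summable_mult summable_geometric) simp
  qed
  \<comment> \<open>Moved under the integral, \<phi> turns the vector coefficient into the Cauchy
    integral of a scalar holomorphic function, that is, into its Taylor coefficient.\<close>
  have coeff: "\<phi> (W n) = (deriv ^^ n) (\<lambda>z. \<phi> (F z)) 0 / fact n" if \<phi>: "\<phi> \<in> \<Phi>" for \<phi> n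
  proof -
    define c where "c n = (deriv ^^ n) (\<lambda>z. \<phi> (F z)) 0 / fact n" for n
    have bl: "bounded_linear \<phi>" and cl: "\<And>c x. \<phi> (c *\<^sub>C x) = c * \<phi> x"
      using sep \<phi> by (auto simp: separating_functionals_def)
    have c: "(\<lambda>n. c n * z ^ n) sums \<phi> (F z)" if "norm z < R" for z
      using holomorphic_power_series[OF hol[OF \<phi>], of z] that by (simp add: c_def)
    \<comment> \<open>Convergence at the larger radius \<open>R'\<close> gives the absolute
      convergence at radius \<open>r\<close> that the coefficient integral requires.\<close>
    obtain R' where R': "r < R'" "R' < R"
      using r(2) dense by blast
    have "summable (\<lambda>n. norm (c n * of_real r ^ n))"
      using R' r sums_summable[OF c, of "of_real R'"]
      by (intro powser_insidea[where x = "of_real R'"]) auto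
    moreover have "(\<lambda>n. cis (real n * \<theta>) * (c n * of_real r ^ n)) sums \<phi> (?G \<theta>)" for \<theta>
      using c[of "of_real r * cis \<theta>"] r by (simp add: norm_mult mult_circle_power)
    ultimately have *: "((\<lambda>\<theta>. cnj (cis (real n * \<theta>)) * \<phi> (?G \<theta>)) has_integral
        of_real (2 * pi) * (c n * of_real r ^ n)) {0..2 * pi}"
      by (rule has_integral_circle_coeff)
    have "((\<lambda>\<theta>. cnj (cis (real n * \<theta>)) *\<^sub>C ?G \<theta>) has_integral J n) {0..2 * pi}"
      unfolding J_def by (intro integrable_integral integrable_continuous_real contI)
    from has_integral_linear[OF this bl]
    have "((\<lambda>\<theta>. cnj (cis (real n * \<theta>)) * \<phi> (?G \<theta>)) has_integral \<phi> (J n)) {0..2 * pi}"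
      by (simp add: o_def cl)
    from this * have "\<phi> (J n) = of_real (2 * pi) * (c n * of_real r ^ n)"
      by (rule has_integral_unique)
    then show ?thesis
      using r by (simp add: W_def cl c_def field_simps)
  qed
  have "(\<lambda>n. \<zeta> ^ n *\<^sub>C W n) sums F \<zeta>" if \<zeta>: "norm \<zeta> < r" for \<zeta>
  proof -
    have s: "(\<lambda>n. \<zeta> ^ n *\<^sub>C W n) sums (\<Sum>n. \<zeta> ^ n *\<^sub>C W n)"
      by (rule summable_sums[OF summable_norm_cancel[OF summ[OF \<zeta>]]])
    have "\<phi> (\<Sum>n. \<zeta> ^ n *\<^sub>C W n) = \<phi> (F \<zeta>)" if \<phi>: "\<phi> \<in> \<Phi>" for \<phi>
    proof -
      have bl: "bounded_linear \<phi>" and cl: "\<And>c x. \<phi> (c *\<^sub>C x) = c * \<phi> x"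
        using sep \<phi> by (auto simp: separating_functionals_def)
      have "(\<lambda>n. \<zeta> ^ n * \<phi> (W n)) sums \<phi> (\<Sum>n. \<zeta> ^ n *\<^sub>C W n)"
        using bounded_linear.sums[OF bl s] by (simp add: cl)
      moreover have "(\<lambda>n. \<zeta> ^ n * \<phi> (W n)) sums \<phi> (F \<zeta>)"
        using holomorphic_power_series[OF hol[OF \<phi>], of \<zeta>] \<zeta> r by (simp add: coeff[OF \<phi>] mult.commute)
      ultimately show ?thesis
        by (rule sums_unique2)
    qed
    with sep s show ?thesis
      unfolding separating_functionals_def by metis
  qed
  with summ that show thesis
    by blast
qed

text \<open>Under each functional the difference of the two series is a scalar series summing to 0
  on the disc. Its coefficients are circle means of the zero function, so they vanish.\<close>

lemma power_series_unique:
  fixes \<Phi> :: "('b::complex_normed_vector \<Rightarrow> complex) set" and W W' :: "nat \<Rightarrow> 'b"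
  assumes sep: "separating_functionals \<Phi>" and r: "r > 0"
    and W: "\<And>\<zeta>. norm \<zeta> < r \<Longrightarrow> (\<lambda>n. \<zeta> ^ n *\<^sub>C W n) sums f \<zeta>"
    and W': "\<And>\<zeta>. norm \<zeta> < r \<Longrightarrow> (\<lambda>n. \<zeta> ^ n *\<^sub>C W' n) sums f \<zeta>"
  shows "W = W'"
proof
  fix n
  have "\<phi> (W n) = \<phi> (W' n)" if \<phi>: "\<phi> \<in> \<Phi>" for \<phi>
  proof -
    have bl: "bounded_linear \<phi>" and cl: "\<And>c x. \<phi> (c *\<^sub>C x) = c * \<phi> x"
      using sep \<phi> by (auto simp: separating_functionals_def)
    define d where "d n = \<phi> (W n) - \<phi> (W' n)" for n
    have d: "(\<lambda>n. d n * \<zeta> ^ n) sums 0" if "norm \<zeta> < r" for \<zeta>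
      using sums_diff[OF bounded_linear.sums[OF bl W] bounded_linear.sums[OF bl W'], OF that that]
      by (simp add: cl d_def algebra_simps)
    obtain q where q: "0 < q" "q < r"
      using r dense by blast
    obtain q' where q': "q < q'" "q' < r"
      using q(2) dense by blast
    have "summable (\<lambda>n. norm (d n * of_real q ^ n))"
      using q q' sums_summable[OF d, of "of_real q'"]
      by (intro powser_insidea[where x = "of_real q'"]) auto
    moreover have "(\<lambda>n. cis (real n * \<theta>) * (d n * of_real q ^ n)) sums 0" for \<theta>
      using d[of "of_real q * cis \<theta>"] q by (simp add: norm_mult mult_circle_power)
    ultimately have "((\<lambda>\<theta>. cnj (cis (real n * \<theta>)) * 0) has_integral
        of_real (2 * pi) * (d n * of_real q ^ n)) {0..2 * pi}"
      by (rule has_integral_circle_coeff)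
    then have "d n = 0"
      using q by simp
    then show ?thesis
      by (simp add: d_def)
  qed
  with sep show "W n = W' n"
    by (auto simp: separating_functionals_def)
qed

section \<open>Complex differentiability in norm: continuity and passage to functionals\<close>

lemma complex_differentiable_at_imp_isCont:
  assumes "complex_differentiable_at f s"
  shows "isCont f s"
proof -
  obtain D where D: "((\<lambda>z. inverse (z - s) *\<^sub>C (f z - f s)) \<longlongrightarrow> D) (at s)"
    using assms by (auto simp: complex_differentiable_at_def)
  have "((\<lambda>z. (z - s) *\<^sub>C (inverse (z - s) *\<^sub>C (f z - f s))) \<longlongrightarrow> (s - s) *\<^sub>C D) (at s)"
    by (intro scaleC.tendsto D tendsto_intros)
  moreover have "\<forall>\<^sub>F z in at s. (z - s) *\<^sub>C (inverse (z - s) *\<^sub>C (f z - f s)) = f z - f s"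
    by (auto simp: eventually_at_filter scaleC_scaleC)
  ultimately have "((\<lambda>z. f z - f s) \<longlongrightarrow> 0) (at s)"
    by (simp add: scaleC.zero_left tendsto_cong)
  then show ?thesis
    by (simp add: isCont_def LIM_zero_iff)
qed

lemma complex_differentiable_at_functional:
  assumes "complex_differentiable_at f s"
    and bl: "bounded_linear \<phi>" and cl: "\<And>c x. \<phi> (c *\<^sub>C x) = c * \<phi> x"
  shows "(\<lambda>z. \<phi> (f z)) field_differentiable at s"
proof -
  obtain D where D: "((\<lambda>z. inverse (z - s) *\<^sub>C (f z - f s)) \<longlongrightarrow> D) (at s)"
    using assms by (auto simp: complex_differentiable_at_def)
  interpret \<phi>: bounded_linear \<phi>
    by (rule bl)
  have "((\<lambda>z. (\<phi> (f z) - \<phi> (f s)) / (z - s)) \<longlongrightarrow> \<phi> D) (at s)"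
    using \<phi>.tendsto[OF D] by (simp add: cl \<phi>.diff divide_inverse mult.commute)
  then show ?thesis
    by (auto simp: field_differentiable_def has_field_derivative_iff)
qed

section \<open>Convolution quadrature\<close>

text \<open>Resolves the definite description: two expansions, each on its own disc about 0, are
  compared on the smaller disc, so exhibiting one expansion identifies the weights.\<close>

lemma cq_weight_eq:
  fixes \<Phi> :: "('b::complex_normed_vector \<Rightarrow> complex) set" and A :: "complex \<Rightarrow> 'b"
  assumes "separating_functionals \<Phi>" and "r > 0"
    and "\<And>\<zeta>. norm \<zeta> < r \<Longrightarrow> (\<lambda>n. \<zeta> ^ n *\<^sub>C W n) sums A (bdf2 \<zeta> / of_real \<Delta>t)"
  shows "cq_weight A \<Delta>t = W"
  unfolding cq_weight_def
proof (rule the_equality)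
  show "\<exists>r>0. \<forall>\<zeta>. norm \<zeta> < r \<longrightarrow> (\<lambda>n. \<zeta> ^ n *\<^sub>C W n) sums A (bdf2 \<zeta> / of_real \<Delta>t)"
    using assms by blast
next
  fix W'
  assume "\<exists>r>0. \<forall>\<zeta>. norm \<zeta> < r \<longrightarrow> (\<lambda>n. \<zeta> ^ n *\<^sub>C W' n) sums A (bdf2 \<zeta> / of_real \<Delta>t)"
  then obtain r' where r': "r' > 0"
    "\<And>\<zeta>. norm \<zeta> < r' \<Longrightarrow> (\<lambda>n. \<zeta> ^ n *\<^sub>C W' n) sums A (bdf2 \<zeta> / of_real \<Delta>t)"
    by blast
  show "W' = W"
    by (rule power_series_unique[OF assms(1), of "min r r'"]) (use assms r' in auto)
qed

text \<open>The circle of radius \<rho> has to lie strictly inside the disc of convergence. Since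
  \<open>A\<close> is analytic near every point of \<open>S\<close> and the closed disc is compact,
  the generating function remains analytic on a slightly larger disc.\<close>

lemma cq_weight_expansion:
  fixes \<Phi> :: "('b::{banach, complex_normed_vector} \<Rightarrow> complex) set" and A :: "complex \<Rightarrow> 'b"
  assumes sep: "separating_functionals \<Phi>"
    and A: "vector_analytic_on A S" and \<rho>: "\<rho> > 0"
    and S: "\<And>\<zeta>. norm \<zeta> \<le> \<rho> \<Longrightarrow> bdf2 \<zeta> / of_real \<Delta>t \<in> S"
    and \<zeta>: "norm \<zeta> \<le> \<rho>"
  shows "summable (\<lambda>n. norm (\<zeta> ^ n *\<^sub>C cq_weight A \<Delta>t n))"
    and "(\<lambda>n. \<zeta> ^ n *\<^sub>C cq_weight A \<Delta>t n) sums A (bdf2 \<zeta> / of_real \<Delta>t)"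
proof -
  \<comment> \<open>\<open>S\<close> may be a closed half-plane; \<open>D\<close> is an open set
    containing it, so its preimage under \<open>g\<close> leaves room around the closed
    disc.\<close>
  define D where "D = interior {s. complex_differentiable_at A s}"
  define g where "g = (\<lambda>\<zeta>. bdf2 \<zeta> / of_real \<Delta>t)"
  have contg: "continuous_on X g" for X
    unfolding g_def bdf2_def divide_inverse by (intro continuous_intros)
  have holg: "g holomorphic_on X" for X
    unfolding g_def bdf2_def divide_inverse by (intro holomorphic_intros)
  have "S \<subseteq> D"
  proof
    fix s assume "s \<in> S"
    then obtain e where "e > 0" "ball s e \<subseteq> {s. complex_differentiable_at A s}"
      using A unfolding vector_analytic_on_def by blast
    then show "s \<in> D"
      by (auto simp: D_def mem_interior)
  qed
  then have "cball 0 \<rho> \<subseteq> g -` D"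
    using S by (force simp: g_def)
  moreover have "open (g -` D)"
    using contg[of UNIV] by (auto simp: D_def continuous_on_open_vimage)
  ultimately obtain \<epsilon> where \<epsilon>: "\<epsilon> > 0" "(\<Union>z\<in>cball 0 \<rho>. ball z \<epsilon>) \<subseteq> g -` D"
    using compact_subset_open_imp_ball_epsilon_subset[OF compact_cball] by metis
  \<comment> \<open>A point outside the closed disc is within \<epsilon> of its radial projection
    \<open>y\<close> onto the circle.\<close>
  have D: "g z \<in> D" if "norm z < \<rho> + \<epsilon>" for z
  proof (cases "norm z \<le> \<rho>")
    case True
    then show ?thesis
      using \<epsilon> by force
  next
    case False
    then have "norm z \<noteq> 0"
      using \<rho> by linarith
    define y where "y = (\<rho> / norm z) *\<^sub>R z"
    have "y - z = (\<rho> / norm z - 1) *\<^sub>R z"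
      by (simp add: y_def algebra_simps)
    then have "norm (y - z) = \<bar>\<rho> / norm z - 1\<bar> * norm z"
      by simp
    also have "\<dots> = norm z - \<rho>"
      using False \<open>norm z \<noteq> 0\<close> \<rho> by (simp add: abs_if field_simps)
    finally have "z \<in> ball y \<epsilon>"
      using that by (simp add: dist_norm)
    moreover have "y \<in> cball 0 \<rho>"
      using \<rho> \<open>norm z \<noteq> 0\<close> by (simp add: y_def)
    ultimately show ?thesis
      using \<epsilon>(2) by blast
  qed
  have diff: "complex_differentiable_at A s" if "s \<in> D" for s
    using that interior_subset by (auto simp: D_def)
  have contA: "continuous_on D A"
    using diff complex_differentiable_at_imp_isCont continuous_at_imp_continuous_on by blast
  have "continuous_on (ball 0 (\<rho> + \<epsilon>)) (\<lambda>z. A (g z))"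
    using D by (intro continuous_on_compose2[OF contA contg]) auto
  moreover have "(\<lambda>z. \<phi> (A (g z))) holomorphic_on ball 0 (\<rho> + \<epsilon>)" if "\<phi> \<in> \<Phi>" for \<phi>
  proof -
    have "(\<lambda>s. \<phi> (A s)) holomorphic_on D"
      using that sep diff complex_differentiable_at_functional
      unfolding separating_functionals_def holomorphic_on_def
      by (metis field_differentiable_at_within)
    then show ?thesis
      using holomorphic_on_compose_gen[OF holg, of "\<lambda>s. \<phi> (A s)" D] D by (force simp: o_def)
  qed
  \<comment> \<open>The radius \<open>\<rho> + \<epsilon> / 2\<close> exceeds \<rho>, so the whole
    circle is covered, and stays below the radius of analyticity.\<close>
  ultimately obtain W where W:
    "\<And>\<zeta>. norm \<zeta> < \<rho> + \<epsilon> / 2 \<Longrightarrow> summable (\<lambda>n. norm (\<zeta> ^ n *\<^sub>C W n))"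
    "\<And>\<zeta>. norm \<zeta> < \<rho> + \<epsilon> / 2 \<Longrightarrow> (\<lambda>n. \<zeta> ^ n *\<^sub>C W n) sums A (g \<zeta>)"
    using vector_power_series[OF sep, of "\<rho> + \<epsilon>" "\<lambda>z. A (g z)" "\<rho> + \<epsilon> / 2"] \<rho> \<epsilon>(1) by auto
  moreover have "cq_weight A \<Delta>t = W"
    using W(2) \<rho> \<epsilon>(1) by (intro cq_weight_eq[OF sep, of "\<rho> + \<epsilon> / 2"]) (auto simp: g_def)
  ultimately show "summable (\<lambda>n. norm (\<zeta> ^ n *\<^sub>C cq_weight A \<Delta>t n))"
    and "(\<lambda>n. \<zeta> ^ n *\<^sub>C cq_weight A \<Delta>t n) sums A (bdf2 \<zeta> / of_real \<Delta>t)"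
    using \<zeta> \<epsilon>(1) by (auto simp: g_def)
qed

text \<open>Splitting \<open>\<zeta> ^ n\<close> into \<open>\<zeta> ^ j\<close> and
  \<open>\<zeta> ^ (n - j)\<close> turns the convolution into a product. As the samples vanish from
  \<open>N\<close> on, the series is a finite sum of shifted weight series, each absolutely
  convergent; complex linearity moves \<open>\<zeta> ^ j\<close> inside the operator.\<close>

lemma conv_quad_generating_function:
  fixes \<Phi> :: "(('a::complex_normed_vector \<Rightarrow>\<^sub>L 'b::{banach, complex_normed_vector}) \<Rightarrow> complex) set"
    and A :: "complex \<Rightarrow> 'a \<Rightarrow>\<^sub>L 'b"
  assumes sep: "separating_functionals \<Phi>"
    and A: "vector_analytic_on A S" and \<rho>: "\<rho> > 0"
    and S: "\<And>\<zeta>. norm \<zeta> \<le> \<rho> \<Longrightarrow> bdf2 \<zeta> / of_real \<Delta>t \<in> S"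
    and lin: "\<And>s. s \<in> S \<Longrightarrow> complex_linear_op (A s)"
    and supp: "\<And>j. j \<ge> N \<Longrightarrow> w (real j * \<Delta>t) = 0"
    and \<zeta>: "norm \<zeta> \<le> \<rho>"
  shows "summable (\<lambda>n. norm (\<zeta> ^ n *\<^sub>C conv_quad A \<Delta>t w n))"
    and "(\<lambda>n. \<zeta> ^ n *\<^sub>C conv_quad A \<Delta>t w n) sums
      blinfun_apply (A (bdf2 \<zeta> / of_real \<Delta>t)) (\<Sum>j<N. \<zeta> ^ j *\<^sub>C w (real j * \<Delta>t))"
proof -
  define W where "W = cq_weight A \<Delta>t"
  define x where "x j = w (real j * \<Delta>t)" for j
  define T where "T = A (bdf2 \<zeta> / of_real \<Delta>t)"
  \<comment> \<open>\<open>t j n\<close> is the share of sample \<open>j\<close> in the term of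
    index \<open>n\<close>. The default 0 keeps truncated subtraction from contributing a spurious
    \<open>W 0\<close> when \<open>j > n\<close>.\<close>
  define t where "t j n = (if j \<le> n then \<zeta> ^ n *\<^sub>C blinfun_apply (W (n - j)) (x j) else 0)" for j n
  have W: "summable (\<lambda>n. norm (\<zeta> ^ n *\<^sub>C W n))" "(\<lambda>n. \<zeta> ^ n *\<^sub>C W n) sums T"
    unfolding W_def T_def by (rule cq_weight_expansion[OF sep A \<rho> _ \<zeta>]; rule S; assumption)+
  have T: "blinfun_apply T (c *\<^sub>C v) = c *\<^sub>C blinfun_apply T v" for c v
    using lin[OF S[OF \<zeta>]] by (simp add: T_def complex_linear_op_def)
  have shift: "t j (n + j) = \<zeta> ^ j *\<^sub>C blinfun_apply (\<zeta> ^ n *\<^sub>C W n) (x j)" for j n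
    by (simp add: t_def scaleC_blinfun.rep_eq scaleC_scaleC power_add mult.commute)
  have sums: "t j sums blinfun_apply T (\<zeta> ^ j *\<^sub>C x j)" for j
  proof -
    have "(\<lambda>n. t j (n + j)) sums (\<zeta> ^ j *\<^sub>C blinfun_apply T (x j))"
      unfolding shift
      by (intro bounded_linear.sums[OF scaleC.bounded_linear_right]
          bounded_linear.sums[OF blinfun.bounded_linear_left] W)
    moreover have "t j n = 0" if "n < j" for n
      using that by (simp add: t_def)
    ultimately show ?thesis
      using sums_zero_iff_shift[of j "t j"] by (simp add: T)
  qed
  have summ: "summable (\<lambda>n. norm (t j n))" for j
  proof -
    have "summable (\<lambda>n. norm (t j (n + j)))"
    proof (rule summable_comparison_test)
      show "\<exists>M. \<forall>n\<ge>M. norm (norm (t j (n + j)))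
          \<le> norm (\<zeta> ^ j) * (norm (\<zeta> ^ n *\<^sub>C W n) * norm (x j))"
        unfolding shift norm_scaleC[of "\<zeta> ^ j"] by (auto intro!: mult_left_mono norm_blinfun)
      show "summable (\<lambda>n. norm (\<zeta> ^ j) * (norm (\<zeta> ^ n *\<^sub>C W n) * norm (x j)))"
        by (intro summable_mult summable_mult2 W)
    qed
    then show ?thesis
      by (rule summable_iff_shift[THEN iffD1])
  qed
  have conv: "(\<Sum>j<N. t j n) = \<zeta> ^ n *\<^sub>C conv_quad A \<Delta>t w n" for n
  proof -
    \<comment> \<open>Both sums live on the indices with \<open>j < N\<close> and
      \<open>j \<le> n\<close>: past \<open>n\<close> the default of \<open>t\<close> is 0, and from
      \<open>N\<close> on the sample is 0.\<close>
    have "(\<Sum>j<N. t j n) = (\<Sum>j=0..n. \<zeta> ^ n *\<^sub>C blinfun_apply (W (n - j)) (x j))"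
      by (rule sum.mono_neutral_cong) (auto simp: t_def x_def supp scaleC.zero_right)
    then show ?thesis
      by (simp add: conv_quad_def W_def x_def scaleC.sum_right)
  qed
  show "summable (\<lambda>n. norm (\<zeta> ^ n *\<^sub>C conv_quad A \<Delta>t w n))"
  proof (rule summable_comparison_test)
    show "\<exists>M. \<forall>n\<ge>M. norm (norm (\<zeta> ^ n *\<^sub>C conv_quad A \<Delta>t w n)) \<le> (\<Sum>j<N. norm (t j n))"
      unfolding conv[symmetric] by (auto intro: norm_sum)
    show "summable (\<lambda>n. \<Sum>j<N. norm (t j n))"
      by (intro summable_sum summ)
  qed
  have "(\<lambda>n. \<Sum>j<N. t j n) sums (\<Sum>j<N. blinfun_apply T (\<zeta> ^ j *\<^sub>C x j))"
    by (intro sums_sum sums)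
  then show "(\<lambda>n. \<zeta> ^ n *\<^sub>C conv_quad A \<Delta>t w n) sums
      blinfun_apply (A (bdf2 \<zeta> / of_real \<Delta>t)) (\<Sum>j<N. \<zeta> ^ j *\<^sub>C w (real j * \<Delta>t))"
    by (simp add: conv T_def x_def blinfun.sum_right)
qed

section \<open>The BDF2 symbol on a disc and the damped positivity estimate\<close>

text \<open>With x and y the real and imaginary parts, twice the difference of the two sides is
  \<open>2 * (\<rho> - x) * (2 - x - \<rho>)\<close> plus \<open>\<rho>^2 - x^2 - y^2\<close>. Both
  terms are nonnegative, the first because x \<le> \<rho> \<le> 1.\<close>

lemma Re_bdf2_ge:
  assumes "norm \<zeta> \<le> \<rho>" "\<rho> \<le> 1"
  shows "Re (bdf2 \<zeta>) \<ge> (1 - \<rho>) * (3 - \<rho>) / 2"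
proof -
  let ?x = "Re \<zeta>" and ?y = "Im \<zeta>"
  have x: "?x \<le> \<rho>"
    using complex_Re_le_cmod[of \<zeta>] assms(1) by linarith
  have "?x\<^sup>2 + ?y\<^sup>2 \<le> \<rho>\<^sup>2"
    using power_mono[OF assms(1) norm_ge_zero, of 2] by (simp add: cmod_power2)
  moreover have "0 \<le> (\<rho> - ?x) * (2 - ?x - \<rho>)"
    using x assms(2) by (intro mult_nonneg_nonneg) auto
  moreover have "2 * Re (bdf2 \<zeta>) = 2 * (1 - ?x) + ((1 - ?x)\<^sup>2 - ?y\<^sup>2)"
    by (simp add: bdf2_def power2_eq_square)
  ultimately show ?thesis
    by (simp add: power2_eq_square algebra_simps)
qed

text \<open>Any frequency set \<open>S\<close> that contains the image of the closed disc will do,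
  which separates the Parseval argument from the choice of \<rho>.\<close>

lemma cq_positivity:
  fixes B :: "complex \<Rightarrow> 'v::complex_hilbert_space \<Rightarrow>\<^sub>L ('v \<Rightarrow>\<^sub>L complex)"
    and R :: "complex \<Rightarrow> 'v \<Rightarrow>\<^sub>L 'v"
  assumes \<rho>: "\<rho> > 0"
    and S: "\<And>\<zeta>. norm \<zeta> \<le> \<rho> \<Longrightarrow> bdf2 \<zeta> / of_real \<Delta>t \<in> S"
    and linB: "\<And>s. s \<in> S \<Longrightarrow> complex_linear_op (B s) \<and> range (blinfun_apply (B s)) \<subseteq> antidual"
    and linR: "\<And>s. s \<in> S \<Longrightarrow> complex_linear_op (R s)"
    and B: "vector_analytic_on B S" and R: "vector_analytic_on R S"
    and pos: "\<And>v s. s \<in> S \<Longrightarrow>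
      Re (anti_duality v (blinfun_apply (B s) v)) \<ge> \<gamma> * (norm (blinfun_apply (R s) v))\<^sup>2"
    and supp: "\<And>j. j \<ge> N \<Longrightarrow> w (real j * \<Delta>t) = 0"
  shows "summable (\<lambda>n. \<rho> ^ (2 * n) * Re (anti_duality (w (real n * \<Delta>t)) (conv_quad B \<Delta>t w n)))"
    and "summable (\<lambda>n. \<rho> ^ (2 * n) * (norm (conv_quad R \<Delta>t w n))\<^sup>2)"
    and "(\<Sum>n. \<rho> ^ (2 * n) * Re (anti_duality (w (real n * \<Delta>t)) (conv_quad B \<Delta>t w n)))
      \<ge> \<gamma> * (\<Sum>n. \<rho> ^ (2 * n) * (norm (conv_quad R \<Delta>t w n))\<^sup>2)"
proof -
  define z where "z \<theta> = of_real \<rho> * cis \<theta>" for \<theta>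
  define s where "s \<theta> = bdf2 (z \<theta>) / of_real \<Delta>t" for \<theta>
  define U where "U \<theta> = (\<Sum>j<N. z \<theta> ^ j *\<^sub>C w (real j * \<Delta>t))" for \<theta>
  have z: "norm (z \<theta>) \<le> \<rho>" for \<theta>
    using \<rho> by (simp add: z_def norm_mult)
  have \<rho>': "norm (complex_of_real \<rho>) \<le> \<rho>"
    using \<rho> by simp
  have s: "s \<theta> \<in> S" for \<theta>
    using S[OF z] by (simp add: s_def)
  have U: "(\<lambda>n. z \<theta> ^ n *\<^sub>C w (real n * \<Delta>t)) sums U \<theta>" for \<theta>
    unfolding U_def by (rule sums_finite) (auto simp: supp scaleC.zero_right)
  have wsum: "summable (\<lambda>n. norm (of_real \<rho> ^ n *\<^sub>C w (real n * \<Delta>t)))"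
    by (rule summable_finite[of "{..<N}"]) (auto simp: supp scaleC.zero_right)
  note genB = conv_quad_generating_function[where w = w and \<Delta>t = \<Delta>t and N = N, OF separating_functionals_apply B \<rho> S
      conjunct1[OF linB] supp]
  note genR = conv_quad_generating_function[where w = w and \<Delta>t = \<Delta>t and N = N, OF separating_functionals_cinner R \<rho> S linR supp]
  have sumsB: "(\<lambda>n. z \<theta> ^ n *\<^sub>C conv_quad B \<Delta>t w n) sums blinfun_apply (B (s \<theta>)) (U \<theta>)" for \<theta>
    unfolding s_def U_def using genB(2) z by blast
  have sumsR: "(\<lambda>n. z \<theta> ^ n *\<^sub>C conv_quad R \<Delta>t w n) sums blinfun_apply (R (s \<theta>)) (U \<theta>)" for \<theta>
    unfolding s_def U_def using genR(2) z by blast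
  have summB: "summable (\<lambda>n. norm (of_real \<rho> ^ n *\<^sub>C conv_quad B \<Delta>t w n))"
    using genB(1) \<rho>' by blast
  have summR: "summable (\<lambda>n. norm (of_real \<rho> ^ n *\<^sub>C conv_quad R \<Delta>t w n))"
    using genR(1) \<rho>' by blast
  have bil: "bounded_bilinear (anti_duality :: 'v \<Rightarrow> _)"
    unfolding anti_duality_def by (rule bounded_bilinear.flip[OF bounded_bilinear_blinfun_apply])
  have antiR: "anti_duality x (c *\<^sub>C f) = c * anti_duality x f" for c f and x :: 'v
    by (simp add: anti_duality_def scaleC_blinfun.rep_eq scaleC_complex_def)
  have antiL: "anti_duality (c *\<^sub>C x) (blinfun_apply (B (s \<theta>)) v) =
      cnj c * anti_duality x (blinfun_apply (B (s \<theta>)) v)" for c x v \<theta>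
    using linB[OF s] by (auto simp: anti_duality_def antidual_def)
  \<comment> \<open>For \<open>B\<close> the left slot carries the transform of \<open>w\<close>,
    and \<open>antiL\<close> holds because \<open>B (s \<theta>)\<close> takes values in
    \<open>antidual\<close>. For \<open>R\<close> both slots carry the same transform, so
    \<open>cinner_same\<close> yields squared norms.\<close>
  note parsevalB = circle_parseval_Re[OF bil antiR antiL wsum summB U[unfolded z_def] sumsB[unfolded z_def]]
  note parsevalR = circle_parseval_Re[OF bounded_bilinear_cinner cinner_scaleC_right
      cinner_scaleC_left summR summR sumsR[unfolded z_def] sumsR[unfolded z_def],
      unfolded cinner_same Re_complex_of_real]
  show "summable (\<lambda>n. \<rho> ^ (2 * n) * Re (anti_duality (w (real n * \<Delta>t)) (conv_quad B \<Delta>t w n)))"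
    by (rule parsevalB)
  show "summable (\<lambda>n. \<rho> ^ (2 * n) * (norm (conv_quad R \<Delta>t w n))\<^sup>2)"
    by (rule parsevalR)
  \<comment> \<open>The integrands are compared pointwise by \<open>pos\<close> at the vector
    \<open>U \<theta>\<close> and frequency \<open>s \<theta>\<close>.\<close>
  have "\<gamma> * (2 * pi * (\<Sum>n. \<rho> ^ (2 * n) * (norm (conv_quad R \<Delta>t w n))\<^sup>2))
      \<le> 2 * pi * (\<Sum>n. \<rho> ^ (2 * n) * Re (anti_duality (w (real n * \<Delta>t)) (conv_quad B \<Delta>t w n)))"
    by (rule has_integral_le[OF has_integral_mult_right[OF parsevalR(2)] parsevalB(2)])
      (rule pos[OF s])
  then have "2 * pi * (\<gamma> * (\<Sum>n. \<rho> ^ (2 * n) * (norm (conv_quad R \<Delta>t w n))\<^sup>2))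
      \<le> 2 * pi * (\<Sum>n. \<rho> ^ (2 * n) * Re (anti_duality (w (real n * \<Delta>t)) (conv_quad B \<Delta>t w n)))"
    by (simp only: mult.left_commute)
  then show "(\<Sum>n. \<rho> ^ (2 * n) * Re (anti_duality (w (real n * \<Delta>t)) (conv_quad B \<Delta>t w n)))
      \<ge> \<gamma> * (\<Sum>n. \<rho> ^ (2 * n) * (norm (conv_quad R \<Delta>t w n))\<^sup>2)"
    by (rule mult_left_le_imp_le) simp
qed

text \<open>With x = \<sigma> h, both \<open>2 - sqrt (1 + 2 * x)\<close> and
  \<open>exp (- x)\<close> expand as 1 - x + O(x^2).\<close>

lemma damping_factor_asymptotics:
  fixes \<sigma> :: real
  assumes "\<sigma> > 0"
  shows "(\<lambda>h. (2 - sqrt (1 + 2 * (\<sigma> * h))) - exp (- \<sigma> * h)) \<in> O[at_right 0](\<lambda>h. h\<^sup>2)"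
  using assms by real_asymp

theorem lemma2p3:
  "\<exists>c>0. \<exists>\<rho> :: real \<Rightarrow> real \<Rightarrow> real.
    (\<forall>\<sigma>>0. (\<lambda>\<Delta>t. \<rho> \<sigma> \<Delta>t - exp (- \<sigma> * \<Delta>t)) \<in> O[at_right 0](\<lambda>\<Delta>t. \<Delta>t\<^sup>2)) \<and>
    (\<forall>(\<sigma>::real) (\<Delta>t::real) (\<gamma>::real) (M::real) (\<mu>::real)
      (B :: complex \<Rightarrow> 'v::complex_hilbert_space \<Rightarrow>\<^sub>L ('v \<Rightarrow>\<^sub>L complex))
      (R :: complex \<Rightarrow> 'v \<Rightarrow>\<^sub>L 'v).
      \<sigma> > 0 \<longrightarrow> \<Delta>t > 0 \<longrightarrow> \<sigma> * \<Delta>t < c \<longrightarrow>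
      (\<forall>s. Re s \<ge> \<sigma> \<longrightarrow> complex_linear_op (B s) \<and> range (blinfun_apply (B s)) \<subseteq> antidual) \<longrightarrow>
      (\<forall>s. Re s \<ge> \<sigma> \<longrightarrow> complex_linear_op (R s)) \<longrightarrow>
      vector_analytic_on B {s. Re s \<ge> \<sigma>} \<longrightarrow>
      vector_analytic_on R {s. Re s \<ge> \<sigma>} \<longrightarrow>
      (\<forall>s. Re s \<ge> \<sigma> \<longrightarrow> norm (B s) \<le> M * norm s powr \<mu>) \<longrightarrow>
      (\<forall>s. Re s \<ge> \<sigma> \<longrightarrow> norm (R s) \<le> M * norm s powr \<mu>) \<longrightarrow>
      (\<forall>w s. Re s \<ge> \<sigma> \<longrightarrow>
        Re (anti_duality w (blinfun_apply (B s) w)) \<ge> \<gamma> * (norm (blinfun_apply (R s) w))\<^sup>2) \<longrightarrow>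
      (\<forall>w :: real \<Rightarrow> 'v. bounded {t \<in> {0..}. w t \<noteq> 0} \<longrightarrow>
        summable (\<lambda>n. \<rho> \<sigma> \<Delta>t ^ (2 * n) *
          Re (anti_duality (w (real n * \<Delta>t)) (conv_quad B \<Delta>t w n))) \<and>
        summable (\<lambda>n. \<rho> \<sigma> \<Delta>t ^ (2 * n) * (norm (conv_quad R \<Delta>t w n))\<^sup>2) \<and>
        (\<Sum>n. \<rho> \<sigma> \<Delta>t ^ (2 * n) *
          Re (anti_duality (w (real n * \<Delta>t)) (conv_quad B \<Delta>t w n)))
        \<ge> \<gamma> * (\<Sum>n. \<rho> \<sigma> \<Delta>t ^ (2 * n) * (norm (conv_quad R \<Delta>t w n))\<^sup>2)))"
proof (intro exI conjI allI impI)
  \<comment> \<open>The smaller root of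
    \<open>(1 - \<rho>) * (3 - \<rho>) / 2 = \<sigma> * \<Delta>t\<close>, the one below 1.\<close>
  let ?\<rho> = "\<lambda>\<sigma> \<Delta>t. 2 - sqrt (1 + 2 * (\<sigma> * \<Delta>t)) :: real"
  \<comment> \<open>The threshold 3/2 is where the root reaches 0: it is positive exactly when
    \<open>1 + 2 * (\<sigma> * \<Delta>t) < 4\<close>.\<close>
  show "(3 / 2 :: real) > 0"
    by simp
  show "(\<lambda>\<Delta>t. ?\<rho> \<sigma> \<Delta>t - exp (- \<sigma> * \<Delta>t)) \<in> O[at_right 0](\<lambda>\<Delta>t. \<Delta>t\<^sup>2)" if "\<sigma> > 0" for \<sigma> :: real
    using that by (rule damping_factor_asymptotics)
  fix \<sigma> \<Delta>t \<gamma> M \<mu> :: real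
    and B :: "complex \<Rightarrow> 'v \<Rightarrow>\<^sub>L ('v \<Rightarrow>\<^sub>L complex)" and R :: "complex \<Rightarrow> 'v \<Rightarrow>\<^sub>L 'v"
    and w :: "real \<Rightarrow> 'v"
  assume \<sigma>: "\<sigma> > 0" and \<Delta>t: "\<Delta>t > 0" and small: "\<sigma> * \<Delta>t < 3 / 2"
    and linB: "\<forall>s. Re s \<ge> \<sigma> \<longrightarrow> complex_linear_op (B s) \<and> range (blinfun_apply (B s)) \<subseteq> antidual"
    and linR: "\<forall>s. Re s \<ge> \<sigma> \<longrightarrow> complex_linear_op (R s)"
    and B: "vector_analytic_on B {s. Re s \<ge> \<sigma>}" and R: "vector_analytic_on R {s. Re s \<ge> \<sigma>}"
    and pos: "\<forall>w s. Re s \<ge> \<sigma> \<longrightarrow>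
      Re (anti_duality w (blinfun_apply (B s) w)) \<ge> \<gamma> * (norm (blinfun_apply (R s) w))\<^sup>2"
    and w: "bounded {t \<in> {0..}. w t \<noteq> 0}"
  define q where "q = sqrt (1 + 2 * (\<sigma> * \<Delta>t))"
  have "\<sigma> * \<Delta>t > 0"
    using \<sigma> \<Delta>t by simp
  then have q: "1 < q" "q\<^sup>2 = 1 + 2 * (\<sigma> * \<Delta>t)"
    by (auto simp: q_def)
  have "q < 2"
    using small real_sqrt_less_mono[of "1 + 2 * (\<sigma> * \<Delta>t)" 4] by (simp add: q_def)
  then have \<rho>: "?\<rho> \<sigma> \<Delta>t > 0"
    by (simp add: q_def)
  have S: "bdf2 \<zeta> / of_real \<Delta>t \<in> {s. Re s \<ge> \<sigma>}" if \<zeta>: "norm \<zeta> \<le> ?\<rho> \<sigma> \<Delta>t" for \<zeta>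
  proof -
    \<comment> \<open>In terms of \<open>q\<close> the bound is (q - 1)(q + 1)/2, which is \<sigma>
      \<Delta>t by the value of q^2; \<open>1 < q\<close> ensures that the radius is at most
      1.\<close>
    have "Re (bdf2 \<zeta>) \<ge> (1 - (2 - q)) * (3 - (2 - q)) / 2"
      using \<zeta> q(1) by (intro Re_bdf2_ge) (auto simp: q_def)
    also have "(1 - (2 - q)) * (3 - (2 - q)) / 2 = \<sigma> * \<Delta>t"
      using q(2) by (simp add: power2_eq_square algebra_simps)
    finally show ?thesis
      using \<Delta>t by (simp add: Re_divide_of_real field_simps)
  qed
  obtain b where b: "\<And>t. t \<ge> 0 \<Longrightarrow> w t \<noteq> 0 \<Longrightarrow> \<bar>t\<bar> \<le> b"
    using w by (auto simp: bounded_iff)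
  \<comment> \<open>The added 1 makes every index from \<open>N\<close> on strictly larger than
    \<open>b / \<Delta>t\<close>. A negative \<open>b\<close>, possible only for empty support, is
    sent to 0 by \<open>nat\<close>.\<close>
  define N where "N = nat \<lceil>b / \<Delta>t\<rceil> + 1"
  have supp: "w (real j * \<Delta>t) = 0" if "j \<ge> N" for j
  proof (rule ccontr)
    assume "w (real j * \<Delta>t) \<noteq> 0"
    then have "real j * \<Delta>t \<le> b"
      using b[of "real j * \<Delta>t"] \<Delta>t by simp
    then have "real j \<le> b / \<Delta>t"
      using \<Delta>t by (simp add: field_simps)
    then show False
      using that unfolding N_def by linarith
  qed
  note res = cq_positivity[where S = "{s. Re s \<ge> \<sigma>}" and w = w and \<Delta>t = \<Delta>t and N = N
      and \<gamma> = \<gamma>, OF \<rho> S _ _ B R _ supp]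
  show "summable (\<lambda>n. ?\<rho> \<sigma> \<Delta>t ^ (2 * n) * Re (anti_duality (w (real n * \<Delta>t)) (conv_quad B \<Delta>t w n)))"
    by (rule res(1)) (use linB linR pos in auto)
  show "summable (\<lambda>n. ?\<rho> \<sigma> \<Delta>t ^ (2 * n) * (norm (conv_quad R \<Delta>t w n))\<^sup>2)"
    by (rule res(2)) (use linB linR pos in auto)
  show "(\<Sum>n. ?\<rho> \<sigma> \<Delta>t ^ (2 * n) * Re (anti_duality (w (real n * \<Delta>t)) (conv_quad B \<Delta>t w n)))
      \<ge> \<gamma> * (\<Sum>n. ?\<rho> \<sigma> \<Delta>t ^ (2 * n) * (norm (conv_quad R \<Delta>t w n))\<^sup>2)"
    by (rule res(3)) (use linB linR pos in auto)
qed

end
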